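(* Let $d\in\mathbb N$. (i) Whenever a shuffle ideal $I\subseteq T(\mathbb R^d)$ is homogeneous, $\mathcal V(I)$ is stable under rescaling. (ii) Whenever a set of paths $M\subseteq C^{2^-\text{-var}}(\mathbb R^d)$ is stable under rescaling, $\mathcal I(M)$ is homogeneous.
   Context: For $d\in\mathbb N$, $C^{2^-\text{-var}}(\mathbb R^d)$ is the set of all continuous $X:[0,T]\to\mathbb R^d$, with $T\in(0,\infty)$ depending on $X$, that have finite $p$-variation for some $p\in[1,2)$. Its elements are called paths. $T(\mathbb R^d)=\bigoplus_{n\ge0}(\mathbb R^d)^{\otimes n}$ is identified with the real vector space spanned by the words in the letters $1,\dots,d$, including the empty word $\mathsf e$; $T((\mathbb R^d))$ is its linear dual. The signature $\sigma(X)\in T((\mathbb R^d))$ is given by $\langle\sigma(X),\mathsf e\rangle=1$ and $\langle\sigma(X),i_1\cdots i_n\rangle=\int_{0<t_1<\dots<t_n<T}dX^{[i_1]}_{t_1}\cdots dX^{[i_n]}_{t_n}$ (iterated Riemann–Stieltjes integrals). $\mathcal V(W)=\{X\in C^{2^-\text{-var}}(\mathbb R^d)\mid\langle\sigma(X),x\rangle=0\ \forall x\in W\}$ for $W\subseteq T(\mathbb R^d)$, and $\mathcal I(M)=\{x\in T(\mathbb R^d)\mid\langle\sigma(X),x\rangle=0\ \forall X\in M\}$ for a set of paths $M$. A shuffle ideal is an ideal of the commutative algebra $T(\mathbb R^d)$ with the shuffle product of words. A subspace of $T(\mathbb R^d)$ is homogeneous if with each element it contains the projections of that element to all $(\mathbb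 R^d)^{\otimes n}$. A set of paths $M$ is stable under rescaling if $\lambda X\in M$ for all $X\in M$ and $\lambda\in\mathbb R$, where $(\lambda X)_t=\lambda X_t$. *)

theory Defs
  imports "HOL-Analysis.Analysis" "HOL-Analysis.Finite_Function_Topology" "HOL-Library.Multiset"
    "HOL-Library.FuncSet"
begin

text \<open>
  Euclidean space of dimension \<open>d\<close> is \<^typ>\<open>real ^ 'd\<close>; the elements of the finite index type
  \<^typ>\<open>'d\<close> are the letters.
\<close>

text \<open>\<open>T(\<real>\<^sup>d)\<close> as the real vector space with the words as basis.\<close>

type_synonym 'd tensor = "'d list \<Rightarrow>\<^sub>0 real"

lift_definition degree_part :: "nat \<Rightarrow> 'd tensor \<Rightarrow> 'd tensor"
  is "\<lambda>n x w. if length w = n then x w else 0"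
  by (rule finite_subset[rotated]) auto

definition homogeneous :: "'d tensor set \<Rightarrow> bool" where
  "homogeneous S \<longleftrightarrow> subspace S \<and> (\<forall>x\<in>S. \<forall>n. degree_part n x \<in> S)"

text \<open>All interleavings of two words, counted with multiplicity.\<close>

fun shuffle_words :: "'d list \<Rightarrow> 'd list \<Rightarrow> 'd list multiset" where
  "shuffle_words [] v = {#v#}"
| "shuffle_words u [] = {#u#}"
| "shuffle_words (a # u) (b # v) =
     image_mset ((#) a) (shuffle_words u (b # v)) + image_mset ((#) b) (shuffle_words (a # u) v)"

definition shuffle :: "'d tensor \<Rightarrow> 'd tensor \<Rightarrow> 'd tensor" where
  "shuffle x y = (\<Sum>u\<in>Poly_Mapping.keys x. \<Sum>v\<in>Poly_Mapping.keys y.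
     (Poly_Mapping.lookup x u * Poly_Mapping.lookup y v) *\<^sub>R
       (\<Sum>w\<in>#shuffle_words u v. Poly_Mapping.single w 1))"

definition shuffle_ideal :: "'d tensor set \<Rightarrow> bool" where
  "shuffle_ideal I \<longleftrightarrow> subspace I \<and> (\<forall>x\<in>I. \<forall>y. shuffle y x \<in> I)"

text \<open>
  A path is a pair of its end time \<open>T\<close> and a function on \<open>[0,T]\<close>; the latter is represented
  extensionally, so that pairs are equal iff the paths are.
\<close>

type_synonym 'd path = "real \<times> (real \<Rightarrow> real ^ 'd)"

text \<open>
  The divisions of \<open>[a,b]\<close> may contain degenerate intervals; these do not contribute to the sum.
\<close>

definition finite_p_variation ::
    "real \<Rightarrow> real \<Rightarrow> real \<Rightarrow> (real \<Rightarrow> 'a::real_normed_vector) \<Rightarrow> bool" where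
  "finite_p_variation p a b f \<longleftrightarrow>
     bdd_above {(\<Sum>K\<in>D. norm (f (Sup K) - f (Inf K)) powr p) |D. D division_of {a..b}}"

definition paths :: "'d::finite path set" where
  "paths = {(T, X). 0 < T \<and> X \<in> extensional {0..T} \<and> continuous_on {0..T} X \<and>
                    (\<exists>p. 1 \<le> p \<and> p < 2 \<and> finite_p_variation p 0 T X)}"

definition rescale :: "real \<Rightarrow> 'd::finite path \<Rightarrow> 'd path" where
  "rescale c = (\<lambda>(T, X). (T, restrict (\<lambda>t. c *\<^sub>R X t) {0..T}))"

definition rescaling_stable :: "'d::finite path set \<Rightarrow> bool" where
  "rescaling_stable M \<longleftrightarrow> (\<forall>X\<in>M. \<forall>c. rescale c X \<in> M)"

text \<open>
  The Riemann-Stieltjes integral of \<open>f\<close> against \<open>g\<close> over \<open>[a,b]\<close>, as a limit of tagged sums when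
  the mesh tends to 0: being fine for the constant gauge \<open>\<lambda>x. ball x \<delta>\<close> bounds the mesh by
  \<open>2 * \<delta>\<close>, and follows from the mesh being smaller than \<open>\<delta>\<close>.
\<close>

definition has_RS_integral ::
    "(real \<Rightarrow> real) \<Rightarrow> (real \<Rightarrow> real) \<Rightarrow> real \<Rightarrow> real \<Rightarrow> real \<Rightarrow> bool" where
  "has_RS_integral f g a b J \<longleftrightarrow>
     (\<forall>\<epsilon>>0. \<exists>\<delta>>0. \<forall>P. P tagged_division_of {a..b} \<and> (\<lambda>x. ball x \<delta>) fine P \<longrightarrow>
        \<bar>(\<Sum>(x, K)\<in>P. f x * (g (Sup K) - g (Inf K))) - J\<bar> < \<epsilon>)"

text \<open>
  As for the library's integrals, the value is 0 if the integral does not exist. In the iterated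
  integrals of elements of \<open>paths\<close> it always exists (Young).
\<close>

definition RS_integral :: "(real \<Rightarrow> real) \<Rightarrow> (real \<Rightarrow> real) \<Rightarrow> real \<Rightarrow> real \<Rightarrow> real" where
  "RS_integral f g a b =
     (if \<exists>J. has_RS_integral f g a b J then THE J. has_RS_integral f g a b J else 0)"

text \<open>
  The iterated integral over \<open>0 < t\<^sub>1 < \<dots> < t\<^sub>n < t\<close> for the word \<open>i\<^sub>1\<dots>i\<^sub>n\<close>, given reversed:
  the outermost integrator belongs to the last letter.
\<close>

fun iterated_integral_rev :: "(real \<Rightarrow> real ^ 'd::finite) \<Rightarrow> 'd list \<Rightarrow> real \<Rightarrow> real" where
  "iterated_integral_rev X [] t = 1"
| "iterated_integral_rev X (i # w) t =
     RS_integral (\<lambda>s. iterated_integral_rev X w s) (\<lambda>s. X s $ i) 0 t"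

definition signature_word :: "'d::finite path \<Rightarrow> 'd list \<Rightarrow> real" where
  "signature_word = (\<lambda>(T, X) w. iterated_integral_rev X (rev w) T)"

text \<open>The signature as a linear functional on \<open>T(\<real>\<^sup>d)\<close>, by linear extension from words.\<close>

definition signature :: "'d::finite path \<Rightarrow> 'd tensor \<Rightarrow> real" where
  "signature X x =
     (\<Sum>w\<in>Poly_Mapping.keys x. Poly_Mapping.lookup x w * signature_word X w)"

definition path_variety :: "'d::finite tensor set \<Rightarrow> 'd path set" where
  "path_variety W = {X \<in> paths. \<forall>x\<in>W. signature X x = 0}"

definition vanishing_ideal :: "'d::finite path set \<Rightarrow> 'd tensor set" where
  "vanishing_ideal M = {x. \<forall>X\<in>M. signature X x = 0}"

end

theory Submission
  imports Defs
begin

text \<open>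
  Rescaling a path by \<open>c\<close> multiplies the signature coefficient of a word of length \<open>n\<close> by \<open>c ^ n\<close>.
  So the value of the signature of the rescaled path at \<open>x\<close> is a polynomial in \<open>c\<close>, whose
  coefficients are the values of the original signature at the homogeneous components of \<open>x\<close>;
  both claims compare this polynomial with its coefficients.
\<close>

section \<open>Riemann-Stieltjes integrals of scaled functions\<close>

text \<open>Later scaling relations hold only on \<open>{a..b}\<close>, so a Riemann sum can be
  rewritten only once its tags and end points are located there.\<close>

lemma tagged_division_Inf_Sup_in:
  fixes a b :: real
  assumes "P tagged_division_of {a..b}" "(x, K) \<in> P"
  shows "x \<in> {a..b}" "Inf K \<in> {a..b}" "Sup K \<in> {a..b}"
proof -
  note K = tagged_division_ofD(2-4)[OF assms]
  then obtain u v where uv: "K = {u..v}" by auto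
  with K have "u \<le> v" by auto
  with K uv show "x \<in> {a..b}" "Inf K \<in> {a..b}" "Sup K \<in> {a..b}" by auto
qed

lemma division_Inf_Sup_in:
  fixes a b :: real
  assumes "D division_of {a..b}" "K \<in> D"
  shows "Inf K \<in> {a..b}" "Sup K \<in> {a..b}"
proof -
  note K = division_ofD(2-4)[OF assms]
  then obtain u v where uv: "K = {u..v}" by auto
  with K have "u \<le> v" by auto
  with K uv show "Inf K \<in> {a..b}" "Sup K \<in> {a..b}" by auto
qed

text \<open>A tagged division fine for the smaller of two radii has a Riemann sum close to both
  values. This justifies the \<open>THE\<close> in \<open>RS_integral\<close>.\<close>

lemma has_RS_integral_unique:
  assumes "has_RS_integral f g a b J" "has_RS_integral f g a b J'"
  shows "J = J'"
proof (rule ccontr)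
  assume "J \<noteq> J'"
  define e where "e = \<bar>J - J'\<bar> / 2"
  have e: "e > 0" using \<open>J \<noteq> J'\<close> by (simp add: e_def)
  define S where "S = (\<lambda>P. \<Sum>(x, K)\<in>P. f x * (g (Sup K) - g (Inf K)))"
  obtain d where d: "d > 0"
    "\<And>P. P tagged_division_of {a..b} \<Longrightarrow> (\<lambda>x. ball x d) fine P \<Longrightarrow> \<bar>S P - J\<bar> < e"
    using assms(1) e unfolding has_RS_integral_def S_def by meson
  obtain d' where d': "d' > 0"
    "\<And>P. P tagged_division_of {a..b} \<Longrightarrow> (\<lambda>x. ball x d') fine P \<Longrightarrow> \<bar>S P - J'\<bar> < e"
    using assms(2) e unfolding has_RS_integral_def S_def by meson
  have "gauge (\<lambda>x::real. ball x (min d d'))"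
    using d(1) d'(1) by (simp add: gauge_def)
  then obtain P where P: "P tagged_division_of {a..b}" "(\<lambda>x. ball x (min d d')) fine P"
    by (rule fine_division_exists_real)
  have "(\<lambda>x. ball x d) fine P" "(\<lambda>x. ball x d') fine P"
    using P(2) by (fastforce simp: fine_def)+
  then have "\<bar>S P - J\<bar> < e" "\<bar>S P - J'\<bar> < e" using d d' P(1) by auto
  then have "\<bar>J - J'\<bar> < 2 * e" by linarith
  then show False by (simp add: e_def)
qed

lemma RS_integral_eqI: "has_RS_integral f g a b J \<Longrightarrow> RS_integral f g a b = J"
  unfolding RS_integral_def by (auto intro: has_RS_integral_unique)

text \<open>Every Riemann sum picks up the factor \<open>c * e\<close>. The relations are asked for
  on \<open>{a..b}\<close> alone because \<open>restrict\<close> cuts rescaled paths off outside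
  their domain.\<close>

lemma has_RS_integral_scale:
  assumes "has_RS_integral f g a b J"
    and f': "\<And>x. x \<in> {a..b} \<Longrightarrow> f' x = c * f x"
    and g': "\<And>x. x \<in> {a..b} \<Longrightarrow> g' x = e * g x"
  shows "has_RS_integral f' g' a b (c * e * J)"
  unfolding has_RS_integral_def
proof (intro allI impI)
  fix \<epsilon> :: real
  assume "\<epsilon> > 0"
  \<comment> \<open>The summand 1 keeps the denominator positive when
    \<open>c * e = 0\<close>.\<close>
  define \<eta> where "\<eta> = \<epsilon> / (\<bar>c * e\<bar> + 1)"
  have "\<eta> > 0" using \<open>\<epsilon> > 0\<close> by (simp add: \<eta>_def add_nonneg_pos)
  then obtain d where d: "d > 0"
    "\<And>P. P tagged_division_of {a..b} \<Longrightarrow> (\<lambda>x. ball x d) fine P \<Longrightarrow>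
      \<bar>(\<Sum>(x, K)\<in>P. f x * (g (Sup K) - g (Inf K))) - J\<bar> < \<eta>"
    using assms(1) unfolding has_RS_integral_def by meson
  have "\<bar>(\<Sum>(x, K)\<in>P. f' x * (g' (Sup K) - g' (Inf K))) - c * e * J\<bar> < \<epsilon>"
    if P: "P tagged_division_of {a..b}" "(\<lambda>x. ball x d) fine P" for P
  proof -
    let ?S = "\<Sum>(x, K)\<in>P. f x * (g (Sup K) - g (Inf K))"
    have "(\<Sum>(x, K)\<in>P. f' x * (g' (Sup K) - g' (Inf K))) = c * e * ?S"
      unfolding sum_distrib_left
    proof (rule sum.cong[OF refl])
      fix xK assume "xK \<in> P"
      then obtain x K where "xK = (x, K)" "(x, K) \<in> P" by (cases xK) auto
      with tagged_division_Inf_Sup_in[OF P(1), of x K]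
      show "(case xK of (x, K) \<Rightarrow> f' x * (g' (Sup K) - g' (Inf K))) =
            c * e * (case xK of (x, K) \<Rightarrow> f x * (g (Sup K) - g (Inf K)))"
        by (simp add: f' g' algebra_simps)
    qed
    then have "\<bar>(\<Sum>(x, K)\<in>P. f' x * (g' (Sup K) - g' (Inf K))) - c * e * J\<bar> = \<bar>c * e\<bar> * \<bar>?S - J\<bar>"
      by (simp add: abs_mult[symmetric] right_diff_distrib)
    also have "\<dots> \<le> \<bar>c * e\<bar> * \<eta>"
      using d(2)[OF P] by (intro mult_left_mono) auto
    also have "\<dots> < (\<bar>c * e\<bar> + 1) * \<eta>"
      using \<open>\<eta> > 0\<close> by (simp add: distrib_right)
    also have "\<dots> = \<epsilon>"
      unfolding \<eta>_def using abs_ge_zero[of "c * e"] by (simp add: add_nonneg_eq_0_iff)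
    finally show ?thesis .
  qed
  with d(1) show "\<exists>\<delta>>0. \<forall>P. P tagged_division_of {a..b} \<and> (\<lambda>x. ball x \<delta>) fine P \<longrightarrow>
      \<bar>(\<Sum>(x, K)\<in>P. f' x * (g' (Sup K) - g' (Inf K))) - c * e * J\<bar> < \<epsilon>"
    by blast
qed

text \<open>
  No integrability is assumed: for \<open>c * e \<noteq> 0\<close> the two integrals exist or fail to exist
  together, and for \<open>c * e = 0\<close> all Riemann sums on the left vanish.
\<close>

lemma RS_integral_scale:
  assumes f': "\<And>x. x \<in> {a..b} \<Longrightarrow> f' x = c * f x"
    and g': "\<And>x. x \<in> {a..b} \<Longrightarrow> g' x = e * g x"
  shows "RS_integral f' g' a b = c * e * RS_integral f g a b"
proof (cases "\<exists>J. has_RS_integral f g a b J")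
  case True
  then obtain J where J: "has_RS_integral f g a b J" ..
  show ?thesis
    using RS_integral_eqI[OF has_RS_integral_scale[OF J f' g']] RS_integral_eqI[OF J] by simp
next
  case False
  then have 0: "RS_integral f g a b = 0" by (simp add: RS_integral_def)
  consider "c = 0" | "e = 0" | "c \<noteq> 0" "e \<noteq> 0" by blast
  then show ?thesis
  proof cases
    case 1
    \<comment> \<open>The integral of \<open>f\<close> does not exist here, so the scaling starts
      from the zero integrand, of which \<open>f'\<close> is a multiple on
      \<open>{a..b}\<close>.\<close>
    have "has_RS_integral (\<lambda>x. 0) g a b 0"
      by (auto simp: has_RS_integral_def intro: exI[of _ 1])
    from has_RS_integral_scale[OF this, of f' 1 g' e] 1 f' g' have "has_RS_integral f' g' a b 0"
      by simp
    then show ?thesis using 0 by (simp add: RS_integral_eqI)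
  next
    case 2
    have "has_RS_integral f (\<lambda>x. 0) a b 0"
      by (auto simp: has_RS_integral_def intro: exI[of _ 1])
    from has_RS_integral_scale[OF this, of f' c g' 1] 2 f' g' have "has_RS_integral f' g' a b 0"
      by simp
    then show ?thesis using 0 by (simp add: RS_integral_eqI)
  next
    case 3
    have "\<not> has_RS_integral f' g' a b J" for J
    proof
      assume "has_RS_integral f' g' a b J"
      then have "has_RS_integral f g a b (inverse c * inverse e * J)"
        by (rule has_RS_integral_scale) (use 3 f' g' in auto)
      with False show False by blast
    qed
    then have "RS_integral f' g' a b = 0" by (simp add: RS_integral_def)
    with 0 show ?thesis by simp
  qed
qed

section \<open>Iterated integrals and variation of rescaled paths\<close>

text \<open>Each letter brings in one integrator and with it one factor \<open>c\<close>. The upper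
  limit \<open>t\<close> varies in the induction, since the inner integral is the integrand of the
  outer one.\<close>

lemma iterated_integral_rev_scale:
  assumes "\<And>s. s \<in> {0..T} \<Longrightarrow> Y s = c *\<^sub>R X s" "t \<in> {0..T}"
  shows "iterated_integral_rev Y w t = c ^ length w * iterated_integral_rev X w t"
  using assms(2)
proof (induction w arbitrary: t)
  case (Cons i w)
  \<comment> \<open>The power comes from the integrand by induction, the extra \<open>c\<close> from
    the integrator.\<close>
  have "iterated_integral_rev Y (i # w) t = c ^ length w * c * iterated_integral_rev X (i # w) t"
    unfolding iterated_integral_rev.simps
    by (rule RS_integral_scale) (use Cons assms(1) in auto)
  then show ?case by simp
qed simp

lemma signature_word_rescale:
  assumes "X \<in> paths"
  shows "signature_word (rescale c X) w = c ^ length w * signature_word X w"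
proof -
  obtain T f where X: "X = (T, f)" by (cases X)
  with assms have "0 < T" by (simp add: paths_def)
  then have "iterated_integral_rev (restrict (\<lambda>t. c *\<^sub>R f t) {0..T}) (rev w) T =
      c ^ length (rev w) * iterated_integral_rev f (rev w) T"
    by (intro iterated_integral_rev_scale[where T = T]) auto
  then show ?thesis by (simp add: X signature_word_def rescale_def)
qed

text \<open>Each summand is multiplied by \<open>\<bar>c\<bar> powr p\<close>, hence so is any
  bound; this covers \<open>c = 0\<close>, as \<open>0 powr p = 0\<close>.\<close>

lemma finite_p_variation_scale:
  assumes "finite_p_variation p a b f" and g: "\<And>x. x \<in> {a..b} \<Longrightarrow> g x = c *\<^sub>R f x"
  shows "finite_p_variation p a b g"
proof -
  obtain B where B: "\<And>D. D division_of {a..b} \<Longrightarrow>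
      (\<Sum>K\<in>D. norm (f (Sup K) - f (Inf K)) powr p) \<le> B"
    using assms(1) unfolding finite_p_variation_def bdd_above_def by blast
  have "(\<Sum>K\<in>D. norm (g (Sup K) - g (Inf K)) powr p) \<le> \<bar>c\<bar> powr p * B"
    if D: "D division_of {a..b}" for D
  proof -
    have "norm (g (Sup K) - g (Inf K)) powr p = \<bar>c\<bar> powr p * norm (f (Sup K) - f (Inf K)) powr p"
      if "K \<in> D" for K
      using division_Inf_Sup_in[OF D that]
      by (simp add: g scaleR_diff_right[symmetric] powr_mult)
    then have "(\<Sum>K\<in>D. norm (g (Sup K) - g (Inf K)) powr p) =
        \<bar>c\<bar> powr p * (\<Sum>K\<in>D. norm (f (Sup K) - f (Inf K)) powr p)"
      by (simp add: sum_distrib_left)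
    also have "\<dots> \<le> \<bar>c\<bar> powr p * B" using B[OF D] by (intro mult_left_mono) auto
    finally show ?thesis .
  qed
  then show ?thesis unfolding finite_p_variation_def bdd_above_def by blast
qed

text \<open>The same exponent \<open>p\<close> works. Membership in \<open>path_variety\<close>
  includes being a path, so the first claim relies on this.\<close>

lemma rescale_in_paths:
  assumes "X \<in> paths"
  shows "rescale c X \<in> paths"
proof -
  obtain T f p where X: "X = (T, f)" "0 < T" "continuous_on {0..T} f"
    "1 \<le> p" "p < 2" "finite_p_variation p 0 T f"
    using assms unfolding paths_def by auto
  let ?g = "restrict (\<lambda>t. c *\<^sub>R f t) {0..T}"
  have "continuous_on {0..T} (\<lambda>t. c *\<^sub>R f t)" using X(3) by (intro continuous_intros)
  then have "continuous_on {0..T} ?g" by (subst continuous_on_cong[OF refl]) auto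
  moreover have "finite_p_variation p 0 T ?g"
    using X(6) by (rule finite_p_variation_scale[where c = c]) simp
  ultimately show ?thesis using X by (auto simp: rescale_def paths_def)
qed

section \<open>The signature as a linear functional, split by word length\<close>

text \<open>Words outside the support contribute 0. Sums for tensors with different supports can
  thus be compared over a common index set.\<close>

lemma signature_eq_sum:
  assumes "finite A" "Poly_Mapping.keys x \<subseteq> A"
  shows "signature X x = (\<Sum>w\<in>A. Poly_Mapping.lookup x w * signature_word X w)"
  unfolding signature_def using assms by (intro sum.mono_neutral_left) (auto simp: in_keys_iff)

lemma lookup_scaleR:
  "Poly_Mapping.lookup (c *\<^sub>R x) w = c * Poly_Mapping.lookup x w" for c :: real
proof -
  \<comment> \<open>Scalar multiples are defined through \<open>Abs_poly_mapping\<close>, which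
    \<open>lookup\<close> inverts on functions of finite support.\<close>
  have "finite {w. c * Poly_Mapping.lookup x w \<noteq> 0}"
    by (rule finite_subset[OF _ finite_lookup[of x]]) auto
  then show ?thesis by (simp add: scaleR_poly_mapping_def)
qed

lemma linear_signature: "linear (signature X)"
proof (rule linearI)
  fix x y :: "'a tensor" and c :: real
  let ?A = "Poly_Mapping.keys x \<union> Poly_Mapping.keys y"
  have "Poly_Mapping.keys (x + y) \<subseteq> ?A" by (rule keys_add)
  then show "signature X (x + y) = signature X x + signature X y"
    by (simp add: signature_eq_sum[of ?A] lookup_add distrib_right sum.distrib)
  have "Poly_Mapping.keys (c *\<^sub>R x) \<subseteq> Poly_Mapping.keys x"
    by (auto simp: in_keys_iff lookup_scaleR)
  then show "signature X (c *\<^sub>R x) = c *\<^sub>R signature X x"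
    by (simp add: signature_eq_sum[of "Poly_Mapping.keys x"] lookup_scaleR
        sum_distrib_left mult.assoc)
qed

lemma signature_degree_part:
  "signature X (degree_part n x) =
    (\<Sum>w | w \<in> Poly_Mapping.keys x \<and> length w = n. Poly_Mapping.lookup x w * signature_word X w)"
proof -
  have "Poly_Mapping.keys (degree_part n x) \<subseteq> Poly_Mapping.keys x"
    by (auto simp: in_keys_iff degree_part.rep_eq split: if_splits)
  then have "signature X (degree_part n x) = (\<Sum>w\<in>Poly_Mapping.keys x.
      if length w = n then Poly_Mapping.lookup x w * signature_word X w else 0)"
    by (subst signature_eq_sum[of "Poly_Mapping.keys x"])
      (auto simp: degree_part.rep_eq intro!: sum.cong)
  then show ?thesis by (simp add: sum.inter_filter)
qed

text \<open>Words of the same length \<open>n\<close> share the factor \<open>c ^ n\<close>. The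
  bound \<open>N\<close> ensures that every word of the support lies in one of the groups
  \<open>n \<le> N\<close>.\<close>

lemma signature_rescale:
  assumes X: "X \<in> paths" and N: "\<And>w. w \<in> Poly_Mapping.keys x \<Longrightarrow> length w \<le> N"
  shows "signature (rescale c X) x = (\<Sum>n\<le>N. signature X (degree_part n x) * c ^ n)"
proof -
  let ?K = "Poly_Mapping.keys x"
  have "(\<Sum>n\<le>N. signature X (degree_part n x) * c ^ n) = (\<Sum>n\<le>N.
      \<Sum>w | w \<in> ?K \<and> length w = n. Poly_Mapping.lookup x w * (c ^ length w * signature_word X w))"
    unfolding signature_degree_part sum_distrib_right by (intro sum.cong) auto
  also have "\<dots> = (\<Sum>w\<in>?K. Poly_Mapping.lookup x w * (c ^ length w * signature_word X w))"
    by (rule sum.group) (use N in auto)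
  finally show ?thesis by (simp add: signature_def signature_word_rescale[OF X])
qed

section \<open>Rescaling of varieties and grading of vanishing ideals\<close>

text \<open>The components of \<open>x\<close> lie in \<open>I\<close> again, so every coefficient
  of the polynomial in \<open>c\<close> is zero.\<close>

lemma rescaling_stable_path_variety:
  assumes "homogeneous I"
  shows "rescaling_stable (path_variety I)"
  unfolding rescaling_stable_def
proof (intro ballI allI)
  fix X c
  assume "X \<in> path_variety I"
  then have X: "X \<in> paths" "\<And>x. x \<in> I \<Longrightarrow> signature X x = 0" by (auto simp: path_variety_def)
  have "signature (rescale c X) x = 0" if "x \<in> I" for x
  proof -
    obtain N where N: "\<And>w. w \<in> Poly_Mapping.keys x \<Longrightarrow> length w \<le> N"
      using finite_nat_set_iff_bounded_le[of "length ` Poly_Mapping.keys x"] by auto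
    have "signature X (degree_part n x) = 0" for n
      using assms that X(2) by (simp add: homogeneous_def)
    then show ?thesis by (simp add: signature_rescale[OF X(1) N])
  qed
  with X(1) show "rescale c X \<in> path_variety I"
    by (simp add: path_variety_def rescale_in_paths)
qed

text \<open>Stability makes the polynomial in \<open>c\<close> vanish at every real number, which
  forces each coefficient to be zero.\<close>

lemma homogeneous_vanishing_ideal:
  fixes M :: "'d::finite path set"
  assumes "M \<subseteq> paths" "rescaling_stable M"
  shows "homogeneous (vanishing_ideal M)"
  unfolding homogeneous_def
proof (intro conjI ballI allI)
  show "subspace (vanishing_ideal M)"
    unfolding subspace_def vanishing_ideal_def
    by (auto simp: linear_0[OF linear_signature] linear_add[OF linear_signature]
        linear_cmul[OF linear_signature])
next
  fix x n
  assume x: "x \<in> vanishing_ideal M"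
  obtain N where N: "\<And>w. w \<in> Poly_Mapping.keys x \<Longrightarrow> length w \<le> N"
    using finite_nat_set_iff_bounded_le[of "length ` Poly_Mapping.keys x"] by auto
  have "signature X (degree_part n x) = 0" if "X \<in> M" for X
  proof (cases "n \<le> N")
    case True
    have "(\<Sum>k\<le>N. signature X (degree_part k x) * c ^ k) = 0" for c
    proof -
      have "rescale c X \<in> M" using assms(2) that by (simp add: rescaling_stable_def)
      then have "signature (rescale c X) x = 0" using x by (simp add: vanishing_ideal_def)
      with signature_rescale[of X x N c] assms(1) that N show ?thesis by auto
    qed
    with True show ?thesis
      using polyfun_eq_0[of "\<lambda>k. signature X (degree_part k x)" N] by blast
  next
    case False
    \<comment> \<open>Above \<open>N\<close> there is no coefficient to compare, but the component
      of \<open>x\<close> is then an empty sum.\<close>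
    then have "{w \<in> Poly_Mapping.keys x. length w = n} = {}" using N by auto
    then show ?thesis by (simp only: signature_degree_part sum.empty)
  qed
  then show "degree_part n x \<in> vanishing_ideal M" by (simp add: vanishing_ideal_def)
qed

theorem proposition5p1:
  "(\<forall>I :: 'd::finite tensor set.
      shuffle_ideal I \<and> homogeneous I \<longrightarrow> rescaling_stable (path_variety I)) \<and>
   (\<forall>M :: 'd path set.
      M \<subseteq> paths \<and> rescaling_stable M \<longrightarrow> homogeneous (vanishing_ideal M))"
  using rescaling_stable_path_variety homogeneous_vanishing_ideal by blast

end
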